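(* Let $(X,\|\cdot\|)$ be a (real or complex) infinite-dimensional separable Banach space and let $A$ be a chaotic linear operator in $X$ satisfying the following: $A$ is densely defined, each power $A^n$ ($n\in\mathbb N$) is a closed operator, and there exist a set $Y\subseteq C^\infty(A):=\bigcap_{n=1}^\infty D(A^n)$ dense in $X$ and a mapping $B:Y\to Y$ such that (1) for every $f\in Y$: $ABf=f$; and (2) for every $f\in Y$ there exist $\alpha=\alpha(f)\in(0,1)$ and $c=c(f,\alpha)>0$ such that for all $n\in\mathbb N$: $\max\left(\|A^nf\|,\|B^nf\|\right)\le c\,\alpha^n$. Then each power $A^n$ ($n\in\mathbb N$) is chaotic.
   Context: Operators may be unbounded; $D(\cdot)$ denotes the domain of an operator. The mapping $B:Y\to Y$ is not assumed linear or continuous, and $Y$ is only a set. A linear operator $T$ in a Banach space $X$ is called hypercyclic if there is a nonzero vector $f\in\bigcap_{n=0}^\infty D(T^n)$ (with $T^0:=I$) whose orbit $\{T^nf\}_{n\ge 0}$ is dense in $X$. A vector $f$ is a periodic point of $T$ if for some $N\in\mathbb N=\{1,2,\dots\}$ one has $f\in D(T^N)$ and $T^Nf=f$. The operator $T$ is called chaotic if it is hypercyclic and its set of periodic points is dense in $X$. *)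

theory Defs
  imports "HOL-Analysis.Analysis"
begin

text \<open>
  Real and complex Banach spaces are treated uniformly: the scalars \<open>'k\<close> form a
  real normed field, i.e. (Gelfand--Mazur) the reals or the complex numbers, and the
  ambient type carries, via class \<open>banach\<close>, the underlying real Banach space.
  For \<open>'k = real\<close> the last axiom forces \<open>scale = scaleR\<close>; for \<open>'k = complex\<close> it says that
  restricting the complex scalars gives the underlying real structure.
\<close>

locale banach_space_over = vector_space scale
  for scale :: "'k::real_normed_field \<Rightarrow> 'a::banach \<Rightarrow> 'a" +
  assumes norm_scale: "norm (scale c x) = norm c * norm x"
    and scale_of_real: "scale (of_real r) x = r *\<^sub>R x"

text \<open>
  A (possibly unbounded) operator in \<open>'a\<close> is a partial map: \<open>dom T\<close> is its domain \<open>D(T)\<close>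
  and \<open>the (T f)\<close> its value at \<open>f \<in> D(T)\<close>. Composition \<open>\<circ>\<^sub>m\<close> of partial maps has the maximal
  domain, so that \<open>D(T\<^sup>n\<^sup>+\<^sup>1) = {f \<in> D(T\<^sup>n). T\<^sup>n f \<in> D(T)}\<close>, and \<open>T\<^sup>0 = I\<close> has domain \<open>UNIV\<close>.
\<close>

primrec op_power :: "('a \<rightharpoonup> 'a) \<Rightarrow> nat \<Rightarrow> ('a \<rightharpoonup> 'a)" where
  "op_power T 0 = Some"
| "op_power T (Suc n) = T \<circ>\<^sub>m op_power T n"

definition dense_set :: "'a::topological_space set \<Rightarrow> bool" where
  "dense_set S \<longleftrightarrow> closure S = UNIV"

definition closed_operator :: "('a::topological_space \<rightharpoonup> 'a) \<Rightarrow> bool" where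
  "closed_operator T \<longleftrightarrow> closed (Map.graph T)"

definition densely_defined :: "('a::topological_space \<rightharpoonup> 'a) \<Rightarrow> bool" where
  "densely_defined T \<longleftrightarrow> dense_set (dom T)"

definition smooth_vectors :: "('a \<rightharpoonup> 'a) \<Rightarrow> 'a set" where
  "smooth_vectors T = (\<Inter>n\<in>{1..}. dom (op_power T n))"

definition periodic_points :: "('a \<rightharpoonup> 'a) \<Rightarrow> 'a set" where
  "periodic_points T =
    {f. \<exists>N\<ge>1. f \<in> dom (op_power T N) \<and> the (op_power T N f) = f}"

context banach_space_over
begin

definition infinite_dimensional :: bool where
  "infinite_dimensional \<longleftrightarrow> (\<nexists>S. finite S \<and> span S = UNIV)"

definition linear_operator :: "('a \<rightharpoonup> 'a) \<Rightarrow> bool" where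
  "linear_operator T \<longleftrightarrow>
     subspace (dom T) \<and>
     (\<forall>f\<in>dom T. \<forall>g\<in>dom T. the (T (f + g)) = the (T f) + the (T g)) \<and>
     (\<forall>c. \<forall>f\<in>dom T. the (T (scale c f)) = scale c (the (T f)))"

definition hypercyclic :: "('a \<rightharpoonup> 'a) \<Rightarrow> bool" where
  "hypercyclic T \<longleftrightarrow>
     linear_operator T \<and>
     (\<exists>f. f \<noteq> 0 \<and> f \<in> (\<Inter>n. dom (op_power T n)) \<and>
          dense_set (range (\<lambda>n. the (op_power T n f))))"

definition chaotic :: "('a \<rightharpoonup> 'a) \<Rightarrow> bool" where
  "chaotic T \<longleftrightarrow> hypercyclic T \<and> dense_set (periodic_points T)"

end

end

theory Submission
  imports Defs
begin

text \<open>
  Periodic points of \<open>A\<close> are periodic for every power of \<open>A\<close>, so only hypercyclicity is at stake.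
  For it, put \<open>T = A\<^sup>m\<close> and \<open>S = B\<^sup>m\<close>: then \<open>T S = I\<close> on \<open>Y\<close>, and \<open>T\<^sup>n y\<close>, \<open>S\<^sup>n y\<close> tend to \<open>0\<close> for
  \<open>y \<in> Y\<close>. Choose \<open>z\<^sub>k \<in> Y\<close> such that every ball contains \<open>z\<^sub>k\<close> for infinitely many \<open>k\<close>, and
  let \<open>f = \<Sum>\<^sub>k S\<^bsup>n(k)\<^esup> z\<^sub>k\<close> with rapidly increasing \<open>n(k)\<close>. Applying \<open>T\<^bsup>n(i)\<^esup>\<close> termwise, which is legitimate
  because this operator is closed, produces \<open>z\<^sub>i\<close> plus an error that vanishes as \<open>i \<rightarrow> \<infinity>\<close>.
\<close>

section \<open>Powers of partial operators, periodic points and closed operators\<close>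

lemma op_power_add: "op_power T (m + n) = op_power T m \<circ>\<^sub>m op_power T n"
  by (induction m) (auto simp: fun_eq_iff map_comp_def split: option.splits)

lemma op_power_op_power: "op_power (op_power T m) n = op_power T (m * n)"
  by (induction n) (simp_all add: op_power_add)

lemma dom_op_power_antimono:
  assumes "m \<le> n"
  shows "dom (op_power T n) \<subseteq> dom (op_power T m)"
proof -
  obtain l where "n = l + m"
    using assms by (metis add.commute le_Suc_ex)
  then show ?thesis
    by (auto simp: op_power_add map_comp_def split: option.splits)
qed

lemma op_power_fixed:
  assumes "T f = Some f"
  shows "op_power T n f = Some f"
  using assms by (induction n) auto

text \<open>From \<open>A^N f = f\<close> follows \<open>(A^N)^m f = f\<close>; both
  \<open>(A^N)^m\<close> and \<open>(A^m)^N\<close> are \<open>A^(N m)\<close>, so the same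
  \<open>N\<close> serves as a period for \<open>A^m\<close>.\<close>

lemma periodic_points_subset_op_power: "periodic_points A \<subseteq> periodic_points (op_power A m)"
proof
  fix f assume "f \<in> periodic_points A"
  then obtain N where N: "N \<ge> 1" "op_power A N f = Some f"
    by (auto simp: periodic_points_def)
  have "op_power (op_power A N) m f = Some f"
    using N(2) by (rule op_power_fixed)
  then have "op_power (op_power A m) N f = Some f"
    by (simp add: op_power_op_power mult.commute)
  with N(1) show "f \<in> periodic_points (op_power A m)"
    by (auto simp: periodic_points_def)
qed

lemma funpow_mem:
  assumes "S \<in> Y \<rightarrow> Y" "y \<in> Y"
  shows "(S ^^ n) y \<in> Y"
  using assms by (induction n) auto

text \<open>Each \<open>T\<close> cancels one \<open>S\<close>, and every intermediate vector stays
  in \<open>Y\<close>. Equality with \<open>Some\<close> also records that the left argument lies in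
  the domain. The surplus \<open>l\<close> must vary: the induction step uses the hypothesis at
  \<open>Suc l\<close> and then cancels the one remaining \<open>S\<close>.\<close>

lemma op_power_right_inverse:
  assumes S: "S \<in> Y \<rightarrow> Y" and TS: "\<And>y. y \<in> Y \<Longrightarrow> T (S y) = Some y" and y: "y \<in> Y"
  shows "op_power T n ((S ^^ (n + l)) y) = Some ((S ^^ l) y)"
proof (induction n arbitrary: l)
  case (Suc n)
  from Suc[of "Suc l"] have "op_power T n ((S ^^ (Suc n + l)) y) = Some (S ((S ^^ l) y))"
    by simp
  then show ?case
    using TS[OF funpow_mem[OF S y]] by simp
qed simp

text \<open>Closedness stands in for continuity: the pairs of partial sums lie in the graph and
  converge, so their limit does too.\<close>

lemma closed_operator_sums:
  fixes T :: "'a::real_normed_vector \<rightharpoonup> 'a"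
  assumes "closed_operator T"
    and "\<And>n. T (\<Sum>k<n. g k) = Some (\<Sum>k<n. h k)" and "g sums f" "h sums f'"
  shows "T f = Some f'"
proof -
  have "(f, f') \<in> Map.graph T"
  proof (rule closed_sequentially)
    show "closed (Map.graph T)"
      using assms(1) by (simp add: closed_operator_def)
    show "(\<Sum>k<n. g k, \<Sum>k<n. h k) \<in> Map.graph T" for n
      using assms(2) by (simp add: Map.graph_def)
    show "(\<lambda>n. (\<Sum>k<n. g k, \<Sum>k<n. h k)) \<longlonglongrightarrow> (f, f')"
      using assms(3,4) unfolding sums_def by (intro tendsto_Pair)
  qed
  then show ?thesis
    by (simp add: Map.graph_def)
qed

section \<open>Dense sequences and rapidly increasing exponents\<close>

lemma dense_set_dist:
  fixes Y :: "'a::metric_space set"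
  assumes "dense_set Y" "e > 0"
  shows "\<exists>y\<in>Y. dist y x < e"
  using assms closure_approachable[of x Y] by (auto simp: dense_set_def)

text \<open>Enumerate a countable dense set as \<open>c\<close> and, for the code of a pair
  \<open>(n, j)\<close>, pick a point of \<open>Y\<close> within \<open>1 / (j + 1)\<close> of
  \<open>c n\<close>. Letting \<open>j\<close> grow gives ever better approximations of the same
  \<open>c n\<close>, hence infinitely many visits to each ball.\<close>

lemma separable_dense_sequence:
  fixes Y :: "'a::metric_space set"
  assumes "separable_space (euclidean :: 'a topology)" "dense_set Y"
  shows "\<exists>z :: nat \<Rightarrow> 'a. range z \<subseteq> Y \<and> (\<forall>x. \<forall>e>0. \<forall>N. \<exists>i\<ge>N. dist (z i) x < e)"
proof -
  obtain C :: "'a set" where C: "countable C" "dense_set C"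
    using assms(1) by (auto simp: separable_space_def dense_set_def)
  then have "C \<noteq> {}"
    by (auto simp: dense_set_def)
  define c where "c = from_nat_into C"
  have range_c: "range c = C"
    unfolding c_def using \<open>C \<noteq> {}\<close> C(1) by (rule range_from_nat_into)
  have "\<exists>y\<in>Y. dist y (c (fst (prod_decode i))) < 1 / real (Suc (snd (prod_decode i)))" for i
    using assms(2) by (rule dense_set_dist) simp
  then obtain z where z: "\<And>i. z i \<in> Y"
    "\<And>i. dist (z i) (c (fst (prod_decode i))) < 1 / real (Suc (snd (prod_decode i)))"
    by metis
  show ?thesis
  proof (intro exI[of _ z] conjI allI impI)
    show "range z \<subseteq> Y"
      using z(1) by auto
    fix x :: 'a and e :: real and N :: nat
    assume "e > 0"
    then obtain n where n: "dist (c n) x < e / 2"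
      using dense_set_dist[OF C(2), of "e / 2" x] range_c by auto
    obtain j0 where j0: "1 / real (Suc j0) < e / 2"
      using \<open>e > 0\<close> nat_approx_posE[of "e / 2"] by auto
    \<comment> \<open>\<open>j \<ge> j0\<close> ensures the accuracy, and \<open>j \<ge> N\<close>
      pushes the index beyond \<open>N\<close>, since the code of a pair is at least its second
      component.\<close>
    define j where "j = max j0 N"
    have "1 / real (Suc j) \<le> 1 / real (Suc j0)"
      by (intro divide_left_mono) (auto simp: j_def)
    then have "dist (z (prod_encode (n, j))) (c n) < e / 2"
      using z(2)[of "prod_encode (n, j)"] j0 by simp
    then have "dist (z (prod_encode (n, j))) x < e"
      using n dist_triangle[of "z (prod_encode (n, j))" x "c n"] by linarith
    moreover have "prod_encode (n, j) \<ge> N"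
      using le_prod_encode_2[of j n] by (simp add: j_def)
    ultimately show "\<exists>i\<ge>N. dist (z i) x < e"
      by blast
  qed
qed

lemma tendsto_zero_simultaneous_bound:
  fixes u v :: "nat \<Rightarrow> nat \<Rightarrow> 'a::real_normed_vector"
  assumes "\<And>i. u i \<longlonglongrightarrow> 0" "\<And>i. v i \<longlonglongrightarrow> 0" "e > 0"
  shows "\<exists>d. \<forall>l\<ge>d. \<forall>i\<le>k. norm (u i l) \<le> e \<and> norm (v i l) \<le> e"
proof -
  have "\<forall>\<^sub>F l in sequentially. norm (u i l) < e \<and> norm (v i l) < e" for i
    using order_tendstoD(2)[OF tendsto_norm_zero[OF assms(1)] assms(3)]
      order_tendstoD(2)[OF tendsto_norm_zero[OF assms(2)] assms(3)]
    by (rule eventually_conj)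
  then have "\<forall>\<^sub>F l in sequentially. \<forall>i\<in>{..k}. norm (u i l) < e \<and> norm (v i l) < e"
    by (intro eventually_ball_finite) auto
  then show ?thesis
    unfolding eventually_sequentially by (meson atMost_iff less_imp_le)
qed

text \<open>Supplies the exponents of the series: \<open>u\<close> will be the forward orbits and
  \<open>v\<close> the backward orbits of the chosen points. At stage \<open>k\<close> only indices
  up to \<open>k\<close> occur, so one threshold \<open>d k\<close> serves all of them.\<close>

lemma fast_growing_sequence:
  fixes u v :: "nat \<Rightarrow> nat \<Rightarrow> 'a::real_normed_vector"
  assumes "\<And>i. u i \<longlonglongrightarrow> 0" "\<And>i. v i \<longlonglongrightarrow> 0"
  shows "\<exists>n. strict_mono n \<and> (\<forall>k. norm (v k (n k)) \<le> (1/4)^k \<and>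
    (\<forall>i<k. norm (u i (n k - n i)) \<le> (1/4)^k \<and> norm (v k (n k - n i)) \<le> (1/4)^k))"
proof -
  have "\<forall>k. \<exists>d. \<forall>l\<ge>d. \<forall>i\<le>k. norm (u i l) \<le> (1/4)^k \<and> norm (v i l) \<le> (1/4)^k"
    using tendsto_zero_simultaneous_bound[OF assms] by simp
  then obtain d where d: "\<And>k l i. l \<ge> d k \<Longrightarrow> i \<le> k \<Longrightarrow> norm (u i l) \<le> (1/4)^k"
    "\<And>k l i. l \<ge> d k \<Longrightarrow> i \<le> k \<Longrightarrow> norm (v i l) \<le> (1/4)^k"
    by metis
  \<comment> \<open>The last increment before \<open>n k\<close> is \<open>Suc (d k)\<close>, so
    \<open>n k\<close> exceeds every earlier \<open>n i\<close> by more than the threshold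
    \<open>d k\<close>; the \<open>Suc\<close> makes \<open>n\<close> strictly increasing.\<close>
  define n where "n k = (\<Sum>i\<le>k. Suc (d i))" for k
  have mono: "strict_mono n"
    by (simp add: strict_mono_Suc_iff n_def)
  have gap: "d k \<le> n k - n i" if "i < k" for i k
  proof -
    obtain k' where k: "k = Suc k'" "i \<le> k'"
      using \<open>i < k\<close> by (cases k) auto
    then have "n i \<le> n k'"
      using mono by (simp add: strict_mono_less_eq)
    then show ?thesis
      unfolding k(1) by (simp add: n_def)
  qed
  have "d k \<le> n k" for k
    by (cases k) (simp_all add: n_def)
  then have "norm (v k (n k)) \<le> (1/4)^k \<and>
    (\<forall>i<k. norm (u i (n k - n i)) \<le> (1/4)^k \<and> norm (v k (n k - n i)) \<le> (1/4)^k)" for k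
    using d gap by simp
  with mono show ?thesis
    by blast
qed

section \<open>Linear operators and the hypercyclicity criterion\<close>

context banach_space_over
begin

lemma linear_operator_zero:
  assumes "linear_operator T"
  shows "T 0 = Some 0"
proof -
  have "0 \<in> dom T"
    using assms by (simp add: linear_operator_def subspace_0)
  moreover from this have "the (T (scale 0 0)) = scale 0 (the (T 0))"
    using assms unfolding linear_operator_def by blast
  ultimately show ?thesis
    by auto
qed

lemma linear_operator_sum:
  assumes "linear_operator T" "finite F" "\<And>k. k \<in> F \<Longrightarrow> T (g k) = Some (h k)"
  shows "T (sum g F) = Some (sum h F)"
  using assms(2,3)
proof (induction F rule: finite_induct)
  case empty
  then show ?case
    using linear_operator_zero[OF assms(1)] by simp
next
  case (insert k F)
  have "T (g k) = Some (h k)" "T (sum g F) = Some (sum h F)"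
    using insert by auto
  then have dom: "g k \<in> dom T" "sum g F \<in> dom T"
    and the: "the (T (g k)) = h k" "the (T (sum g F)) = sum h F"
    by auto
  have "g k + sum g F \<in> dom T"
    using assms(1) dom by (simp add: linear_operator_def subspace_add)
  moreover have "the (T (g k + sum g F)) = h k + sum h F"
    using assms(1) dom the by (simp add: linear_operator_def)
  ultimately show ?case
    using insert by auto
qed

lemma linear_operator_map_comp:
  assumes "linear_operator S" "linear_operator T"
  shows "linear_operator (S \<circ>\<^sub>m T)"
proof -
  have mem: "f \<in> dom (S \<circ>\<^sub>m T) \<longleftrightarrow> f \<in> dom T \<and> the (T f) \<in> dom S" for f
    by (auto simp: map_comp_def split: option.splits)
  have app: "the ((S \<circ>\<^sub>m T) f) = the (S (the (T f)))" if "f \<in> dom T" for f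
    using that by auto
  have S: "subspace (dom S)" and T: "subspace (dom T)"
    using assms by (simp_all add: linear_operator_def)
  have Tadd: "the (T (f + g)) = the (T f) + the (T g)" if "f \<in> dom T" "g \<in> dom T" for f g
    using assms(2) that by (simp add: linear_operator_def)
  have Tscale: "the (T (scale c f)) = scale c (the (T f))" if "f \<in> dom T" for c f
    using assms(2) that by (simp add: linear_operator_def)
  have Sadd: "the (S (f + g)) = the (S f) + the (S g)" if "f \<in> dom S" "g \<in> dom S" for f g
    using assms(1) that by (simp add: linear_operator_def)
  have Sscale: "the (S (scale c f)) = scale c (the (S f))" if "f \<in> dom S" for c f
    using assms(1) that by (simp add: linear_operator_def)
  have "subspace (dom (S \<circ>\<^sub>m T))"
  proof (rule subspaceI)
    show "0 \<in> dom (S \<circ>\<^sub>m T)"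
      using linear_operator_zero[OF assms(1)] linear_operator_zero[OF assms(2)]
      by (simp add: domIff)
  qed (auto simp only: mem Tadd Tscale subspace_add[OF S] subspace_add[OF T]
      subspace_scale[OF S] subspace_scale[OF T])
  then show ?thesis
    by (simp add: linear_operator_def mem app Tadd Tscale Sadd Sscale subspace_add[OF T]
        subspace_scale[OF T] del: domIff)
qed

lemma linear_operator_op_power:
  assumes "linear_operator T"
  shows "linear_operator (op_power T n)"
proof (induction n)
  case 0
  have "dom (Some :: 'a \<rightharpoonup> 'a) = UNIV"
    by auto
  then show ?case
    by (simp add: linear_operator_def)
next
  case (Suc n)
  then show ?case
    using linear_operator_map_comp[OF assms] by simp
qed

text \<open>Applying \<open>T^(n i)\<close> to the term \<open>S^(n k) z_k\<close> gives
  \<open>T^(n i - n k) z_k\<close> for \<open>k < i\<close>, exactly \<open>z_i\<close> for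
  \<open>k = i\<close>, and \<open>S^(n k - n i) z_k\<close> for \<open>k > i\<close>. By
  \<open>n1\<close> and \<open>n2\<close> the terms with \<open>k \<noteq> i\<close> have norm at
  most \<open>(1/4)^(max i k)\<close>, while \<open>n0\<close> makes the original series
  converge.\<close>

lemma op_power_series_near:
  assumes lin: "linear_operator T" and closed: "\<And>n. n \<ge> 1 \<Longrightarrow> closed_operator (op_power T n)"
    and Y: "Y \<subseteq> (\<Inter>n. dom (op_power T n))" and S: "S \<in> Y \<rightarrow> Y"
    and TS: "\<And>y. y \<in> Y \<Longrightarrow> T (S y) = Some y"
    and z: "range z \<subseteq> Y" and n: "strict_mono n"
    and n0: "\<And>k. norm ((S ^^ n k) (z k)) \<le> (1/4)^k"
    and n1: "\<And>i k. i < k \<Longrightarrow> norm (the (op_power T (n k - n i) (z i))) \<le> (1/4)^k"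
    and n2: "\<And>i k. i < k \<Longrightarrow> norm ((S ^^ (n k - n i)) (z k)) \<le> (1/4)^k"
  shows "\<exists>y. op_power T (n i) (\<Sum>k. (S ^^ n k) (z k)) = Some y \<and> norm (y - z i) \<le> 2 * (1/2)^i"
proof -
  define g where "g k = (S ^^ n k) (z k)" for k
  define u where "u k = the (op_power T (n i) (g k))" for k
  \<comment> \<open>\<open>e\<close> is the ideal image, with sum \<open>z i\<close>; the error is
    then the series of \<open>u k - e k\<close>.\<close>
  define e where "e k = (if k = i then z i else 0)" for k
  have zY: "z k \<in> Y" for k
    using z by auto
  have u: "op_power T (n i) (g k) = Some (u k)" for k
    using funpow_mem[OF S zY] Y unfolding u_def g_def
    by (metis INT_D UNIV_I domIff option.collapse subsetD)
  have lt: "op_power T (n i) (g k) = op_power T (n i - n k) (z k)" if "n k \<le> n i" for k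
  proof -
    have "op_power T (n i - n k + n k) (g k) = op_power T (n i - n k) (z k)"
      using op_power_right_inverse[OF S TS zY, of "n k" 0] unfolding op_power_add
      by (simp add: g_def)
    then show ?thesis
      using that by simp
  qed
  have gt: "op_power T (n i) (g k) = Some ((S ^^ (n k - n i)) (z k))" if "n i \<le> n k" for k
    using op_power_right_inverse[OF S TS zY, of "n i" "n k - n i"] that by (simp add: g_def)
  \<comment> \<open>Splits \<open>(1/4)^k = (1/2)^(2 * k)\<close> into a factor
    \<open>(1/2)^i\<close>, which makes the error small, and a factor \<open>(1/2)^k\<close>, which
    makes it summable.\<close>
  have quarter: "(1/4 :: real) ^ k \<le> (1/2)^j * (1/2)^l" if "j + l \<le> 2 * k" for j k l
  proof -
    have "(1/4 :: real) ^ k = (1/2) ^ (2 * k)"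
      by (simp add: power_mult power2_eq_square)
    also have "\<dots> \<le> (1/2) ^ (j + l)"
      using that by (intro power_decreasing) auto
    finally show ?thesis
      by (simp add: power_add)
  qed
  have bound: "norm (u k - e k) \<le> (1/2)^i * (1/2)^k" for k
  proof (cases k i rule: linorder_cases)
    case less
    then have "norm (u k - e k) \<le> (1/4)^i"
      using lt[of k] n1[of k i] n by (simp add: u_def e_def strict_mono_less_eq)
    also have "\<dots> \<le> (1/2)^i * (1/2)^k"
      using less by (intro quarter) simp
    finally show ?thesis .
  next
    case equal
    then show ?thesis
      using gt[of i] by (simp add: u_def e_def)
  next
    case greater
    then have "norm (u k - e k) \<le> (1/4)^k"
      using gt[of k] n2[of i k] n by (simp add: u_def e_def strict_mono_less_eq)
    also have "\<dots> \<le> (1/2)^i * (1/2)^k"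
      using greater by (intro quarter) simp
    finally show ?thesis .
  qed
  have geometric: "(\<lambda>k. (1/2)^i * (1/2)^k) sums ((1/2)^i * 2 :: real)"
    using geometric_sums[of "1/2 :: real"] by (intro sums_mult) simp
  have "summable g"
    by (rule summable_comparison_test'[OF summable_geometric[of "1/4 :: real"]])
      (use n0 in \<open>auto simp: g_def\<close>)
  then have g: "g sums suminf g"
    by (rule summable_sums)
  have diff: "summable (\<lambda>k. u k - e k)"
    by (rule summable_comparison_test'[OF sums_summable[OF geometric]]) (rule bound)
  have "e sums z i"
    using sums_single[of i "\<lambda>_. z i"] by (simp add: e_def[abs_def])
  from sums_add[OF summable_sums[OF diff] this]
  have usums: "u sums ((\<Sum>k. u k - e k) + z i)"
    by simp
  \<comment> \<open>Closedness is available for exponents at least 1, whereas the conditions on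
    \<open>n\<close> allow \<open>n 0 = 0\<close>; in that case the power is the identity and
    \<open>u\<close> is \<open>g\<close> itself.\<close>
  have "n i \<ge> 1 \<or> n i = 0"
    by linarith
  then have "op_power T (n i) (suminf g) = Some ((\<Sum>k. u k - e k) + z i)"
  proof
    assume "n i \<ge> 1"
    moreover have "op_power T (n i) (\<Sum>k<j. g k) = Some (\<Sum>k<j. u k)" for j
      by (rule linear_operator_sum[OF linear_operator_op_power[OF lin] finite_lessThan u])
    ultimately show ?thesis
      using closed_operator_sums[OF closed _ g usums] by blast
  next
    assume "n i = 0"
    then have "g = u"
      using u by (simp add: fun_eq_iff)
    then show ?thesis
      using \<open>n i = 0\<close> sums_unique[OF usums] by simp
  qed
  moreover have "norm (\<Sum>k. u k - e k) \<le> (\<Sum>k. (1/2)^i * (1/2)^k)"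
    by (rule norm_suminf_le[OF bound sums_summable[OF geometric]])
  then have "norm (\<Sum>k. u k - e k) \<le> 2 * (1/2)^i"
    using sums_unique[OF geometric] by simp
  ultimately show ?thesis
    unfolding g_def[abs_def] by simp
qed

text \<open>The vector \<open>f\<close> shadows the sequence \<open>z\<close> along its orbit:
  \<open>T^(n i) f\<close> is within \<open>2 * (1/2)^i\<close> of \<open>z i\<close>. As
  \<open>z\<close> returns to each ball at arbitrarily late indices, where this error is negligible,
  the orbit is dense.\<close>

lemma hypercyclicity_criterion:
  assumes lin: "linear_operator T" and closed: "\<And>n. n \<ge> 1 \<Longrightarrow> closed_operator (op_power T n)"
    and sep: "separable_space (euclidean :: 'a topology)" and nontrivial: "\<exists>x::'a. x \<noteq> 0"
    and Y: "Y \<subseteq> (\<Inter>n. dom (op_power T n))" and Y_dense: "dense_set Y" and S: "S \<in> Y \<rightarrow> Y"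
    and TS: "\<And>y. y \<in> Y \<Longrightarrow> T (S y) = Some y"
    and T0: "\<And>y. y \<in> Y \<Longrightarrow> (\<lambda>n. the (op_power T n y)) \<longlonglongrightarrow> 0"
    and S0: "\<And>y. y \<in> Y \<Longrightarrow> (\<lambda>n. (S ^^ n) y) \<longlonglongrightarrow> 0"
  shows "hypercyclic T"
proof -
  obtain z :: "nat \<Rightarrow> 'a" where z: "range z \<subseteq> Y"
    and z_dense: "\<forall>x. \<forall>e>0. \<forall>N. \<exists>i\<ge>N. dist (z i) x < e"
    using separable_dense_sequence[OF sep Y_dense] by (elim exE conjE)
  have "z i \<in> Y" for i
    using z by auto
  then have "\<And>i. (\<lambda>l. the (op_power T l (z i))) \<longlonglongrightarrow> 0"
    "\<And>i. (\<lambda>l. (S ^^ l) (z i)) \<longlonglongrightarrow> 0"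
    using T0 S0 by blast+
  from fast_growing_sequence[where u = "\<lambda>i l. the (op_power T l (z i))"
      and v = "\<lambda>i l. (S ^^ l) (z i)", OF this]
  obtain n :: "nat \<Rightarrow> nat" where n: "strict_mono n"
    "\<And>k. norm ((S ^^ n k) (z k)) \<le> (1/4)^k"
    "\<And>i k. i < k \<Longrightarrow> norm (the (op_power T (n k - n i) (z i))) \<le> (1/4)^k"
    "\<And>i k. i < k \<Longrightarrow> norm ((S ^^ (n k - n i)) (z k)) \<le> (1/4)^k"
    by blast
  define f where "f = (\<Sum>k. (S ^^ n k) (z k))"
  have "\<exists>y. op_power T (n i) f = Some y \<and> norm (y - z i) \<le> 2 * (1/2)^i" for i
    unfolding f_def by (rule op_power_series_near[OF lin _ Y S _ z n]) (rule closed TS, assumption)+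
  then obtain y where y: "\<And>i. op_power T (n i) f = Some (y i)"
    "\<And>i. norm (y i - z i) \<le> 2 * (1/2)^i"
    by metis
  \<comment> \<open>Domains of powers decrease and \<open>n j \<ge> j\<close>, so membership at the
    exponents \<open>n j\<close> gives membership at all exponents.\<close>
  have f_dom: "f \<in> dom (op_power T j)" for j
    using dom_op_power_antimono[of j "n j" T] strict_mono_imp_increasing[OF n(1)] y(1)[of j] by auto
  have orbit_dense: "\<exists>j. dist (the (op_power T j f)) x < e" if "e > 0" for x e
  proof -
    have "(\<lambda>i. (1/2 :: real)^i) \<longlonglongrightarrow> 0"
      by (rule LIMSEQ_power_zero) simp
    then have "\<forall>\<^sub>F i in sequentially. (1/2 :: real)^i < e / 4"
      by (rule order_tendstoD(2)) (simp add: \<open>e > 0\<close>)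
    then obtain N where N: "\<forall>i\<ge>N. (1/2 :: real)^i < e / 4"
      unfolding eventually_sequentially by (rule exE)
    obtain i where i: "i \<ge> N" "dist (z i) x < e / 2"
      using z_dense[rule_format, of "e / 2" N x] \<open>e > 0\<close> by auto
    have "dist (y i) (z i) < e / 2"
      using y(2)[of i] N[rule_format, OF i(1)] unfolding dist_norm by linarith
    with i(2) have "dist (y i) x < e"
      using dist_triangle[of "y i" x "z i"] by linarith
    then show ?thesis
      using y(1)[of i] by (intro exI[of _ "n i"]) simp
  qed
  \<comment> \<open>The orbit of 0 stays at 0, which is not closer than \<open>norm x\<close> to a
    nonzero \<open>x\<close>.\<close>
  have "f \<noteq> 0"
  proof
    assume "f = 0"
    obtain x :: 'a where "x \<noteq> 0"
      using nontrivial by blast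
    then obtain j where "dist (the (op_power T j f)) x < norm x"
      using orbit_dense[of "norm x" x] by auto
    then show False
      using linear_operator_zero[OF linear_operator_op_power[OF lin]] \<open>f = 0\<close> by simp
  qed
  moreover have "x \<in> closure (range (\<lambda>j. the (op_power T j f)))" for x
    unfolding closure_approachable by (simp add: orbit_dense)
  then have "dense_set (range (\<lambda>j. the (op_power T j f)))"
    unfolding dense_set_def by blast
  moreover have "f \<in> (\<Inter>j. dom (op_power T j))"
    using f_dom by (rule INT_I)
  ultimately show ?thesis
    unfolding hypercyclic_def using lin by (intro conjI exI[of _ f])
qed

end

section \<open>Chaos of the powers of \<open>A\<close>\<close>

theorem corollary4p5:
  fixes scale :: "'k::real_normed_field \<Rightarrow> 'a::banach \<Rightarrow> 'a"
    and A :: "'a \<rightharpoonup> 'a"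
    and Y :: "'a set"
    and B :: "'a \<Rightarrow> 'a"
  assumes banach: "banach_space_over scale"
    and inf_dim: "banach_space_over.infinite_dimensional scale"
    and separable: "separable_space (euclidean :: 'a topology)"
    and linear: "banach_space_over.linear_operator scale A"
    and chaotic: "banach_space_over.chaotic scale A"
    and dense_dom: "densely_defined A"
    and closed_powers: "\<And>n. n \<ge> 1 \<Longrightarrow> closed_operator (op_power A n)"
    and Y_sub: "Y \<subseteq> smooth_vectors A"
    and Y_dense: "dense_set Y"
    and B_maps: "B \<in> Y \<rightarrow> Y"
    and right_inv: "\<And>f. f \<in> Y \<Longrightarrow> A (B f) = Some f"
    and decay: "\<And>f. f \<in> Y \<Longrightarrow> \<exists>\<alpha>. 0 < \<alpha> \<and> \<alpha> < 1 \<and> (\<exists>c>0. \<forall>n\<ge>1.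
        max (norm (the (op_power A n f))) (norm ((B ^^ n) f)) \<le> c * \<alpha> ^ n)"
  shows "\<forall>n\<ge>1. banach_space_over.chaotic scale (op_power A n)"
proof (intro allI impI)
  interpret banach_space_over scale
    by (rule banach)
  fix m :: nat
  assume m: "m \<ge> 1"
  \<comment> \<open>The zero space is spanned by the empty set, contradicting infinite
    dimension.\<close>
  have "\<exists>x::'a. x \<noteq> 0"
  proof (rule ccontr)
    assume "\<nexists>x::'a. x \<noteq> 0"
    then have "span {} = (UNIV :: 'a set)"
      by auto
    then show False
      using inf_dim unfolding infinite_dimensional_def by blast
  qed
  moreover have "Y \<subseteq> (\<Inter>n. dom (op_power (op_power A m) n))"
  proof
    fix y assume "y \<in> Y"
    \<comment> \<open>\<open>smooth_vectors\<close> intersects over exponents from 1 on; exponent 0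
      is the identity, defined everywhere.\<close>
    have "y \<in> dom (op_power A n)" for n
    proof (cases n)
      case (Suc n')
      then show ?thesis
        using Y_sub \<open>y \<in> Y\<close> by (auto simp: smooth_vectors_def simp del: op_power.simps)
    qed auto
    then show "y \<in> (\<Inter>n. dom (op_power (op_power A m) n))"
      by (simp add: op_power_op_power)
  qed
  moreover have "closed_operator (op_power (op_power A m) n)" if "n \<ge> 1" for n
    unfolding op_power_op_power using m that by (intro closed_powers) simp
  moreover have "B ^^ m \<in> Y \<rightarrow> Y"
    using funpow_mem[OF B_maps] by blast
  moreover have "op_power A m ((B ^^ m) y) = Some y" if "y \<in> Y" for y
    using op_power_right_inverse[OF B_maps right_inv that, of m 0] by simp
  moreover have "(\<lambda>n. the (op_power (op_power A m) n y)) \<longlonglongrightarrow> 0 \<and> (\<lambda>n. ((B ^^ m) ^^ n) y) \<longlonglongrightarrow> 0"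
    if "y \<in> Y" for y
  proof -
    obtain \<alpha> c where \<alpha>: "0 < \<alpha>" "\<alpha> < 1"
      and le: "\<And>n. n \<ge> 1 \<Longrightarrow>
        max (norm (the (op_power A n y))) (norm ((B ^^ n) y)) \<le> c * \<alpha> ^ n"
      using decay[OF \<open>y \<in> Y\<close>] by blast
    have "(\<lambda>n. c * \<alpha> ^ n) \<longlonglongrightarrow> c * 0"
      using \<alpha> by (intro tendsto_mult_left LIMSEQ_power_zero) simp
    then have lim: "(\<lambda>n. c * \<alpha> ^ n) \<longlonglongrightarrow> 0"
      by simp
    have lims: "(\<lambda>n. the (op_power A n y)) \<longlonglongrightarrow> 0" "(\<lambda>n. (B ^^ n) y) \<longlonglongrightarrow> 0"
      using le by (intro Lim_null_comparison[OF _ lim] eventually_sequentiallyI[of 1], force)+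
    \<comment> \<open>The powers of \<open>A^m\<close> and \<open>B^m\<close> run through the
      multiples of \<open>m\<close>, so their orbits are subsequences of null sequences;
      \<open>m \<ge> 1\<close> makes the indices strictly increase.\<close>
    have "strict_mono ((*) m)"
      using m by (simp add: strict_mono_def)
    from lims[THEN LIMSEQ_subseq_LIMSEQ, OF this] show ?thesis
      by (simp add: op_power_op_power funpow_mult o_def)
  qed
  ultimately have "hypercyclic (op_power A m)"
    using linear_operator_op_power[OF linear] separable Y_dense
    by (intro hypercyclicity_criterion[where Y = Y and S = "B ^^ m"]) auto
  moreover have "dense_set (periodic_points (op_power A m))"
    using chaotic closure_mono[OF periodic_points_subset_op_power[of A m]]
    by (auto simp: chaotic_def dense_set_def)
  ultimately show "chaotic (op_power A m)"
    by (simp add: chaotic_def)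
qed

end
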